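(* Let $n$ be a positive integer and let $f:\mathbb{Z}/n\mathbb{Z}\to\mathbb{Z}/n\mathbb{Z}$ be any function. Then $f$ has a linear representation: there exist a positive integer $m$, a constant $a\in\mathbb{Z}/m\mathbb{Z}$, and an injective function $j:\mathbb{Z}/n\mathbb{Z}\to\mathbb{Z}/m\mathbb{Z}$ such that for all $i\in\mathbb{Z}/n\mathbb{Z}$, $$j(f(i)) = a\cdot j(i)\quad\text{in } \mathbb{Z}/m\mathbb{Z}.$$
   Context: The paper identifies a finite set of size $n$ with $\mathbb{Z}/n\mathbb{Z}=\{0,1,\ldots,n-1\}$; "finite function" means a function from such a set to itself. *)

theory Defs
  imports "HOL-Number_Theory.Residues"
begin

end

theory Submission
  imports Defs
begin

text \<open>
  Put \<open>a = n + 1\<close> and read the orbit \<open>x, f x, f (f x), \<dots>\<close> as the base-\<open>a\<close> digits of a real number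
  \<open>\<theta> x\<close> in \<open>[0,1)\<close>. Applying \<open>f\<close> shifts the digits, so \<open>\<theta> (f x)\<close> is the fractional part of
  \<open>a * \<theta> x\<close>, and the leading digit \<open>x\<close> is its integer part. Since \<open>f ^^ q = f ^^ p\<close> for some
  \<open>p < q\<close>, the expansions are eventually periodic and \<open>m = a ^ q - a ^ p\<close> is a common denominator;
  hence \<open>j x = m * \<theta> x\<close> is a linear representation modulo \<open>m\<close>.
\<close>

text \<open>The integer whose base-\<open>a\<close> digits are the first \<open>p\<close> points of the orbit of \<open>x\<close>.\<close>

primrec orbit_number :: "'a::comm_ring_1 \<Rightarrow> ('a \<Rightarrow> 'a) \<Rightarrow> nat \<Rightarrow> 'a \<Rightarrow> 'a" where
  "orbit_number a f 0 x = 0"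
| "orbit_number a f (Suc p) x = a * orbit_number a f p x + (f ^^ p) x"

text \<open>The number with digits \<open>x, f x, \<dots>, (f ^^ p) x\<close>, split off at its last
  digit or at its first.\<close>

lemma orbit_number_shift:
  "a * orbit_number a f p x = a ^ p * x + orbit_number a f p (f x) - (f ^^ p) x"
proof (induction p)
  case 0
  show ?case by simp
next
  case (Suc p)
  have "a * orbit_number a f (Suc p) x = a * (a * orbit_number a f p x) + a * (f ^^ p) x"
    by (simp add: algebra_simps)
  also have "\<dots> = a ^ Suc p * x + a * orbit_number a f p (f x)"
    unfolding Suc by (simp add: algebra_simps)
  finally show ?case by (simp add: funpow_swap1)
qed

lemma finite_funpow_repeats:
  assumes "finite X" "f \<in> X \<rightarrow> X"
  shows "\<exists>p q. p < q \<and> (\<forall>x\<in>X. (f ^^ p) x = (f ^^ q) x)"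
proof -
  let ?F = "\<lambda>p. restrict (f ^^ p) X"
  have "(f ^^ p) x \<in> X" if "x \<in> X" for p x
    using that assms(2) by (induction p) auto
  then have "range ?F \<subseteq> (\<Pi>\<^sub>E x\<in>X. X)"
    by auto
  then have "finite (range ?F)"
    using assms(1) by (meson finite_PiE finite_subset)
  then have "\<not> inj ?F"
    using finite_imageD infinite_UNIV_nat by blast
  then obtain p q where "p < q" "?F p = ?F q"
    by (metis (mono_tags, lifting) injI linorder_neq_iff)
  then show ?thesis
    by (metis restrict_apply')
qed

theorem mainTheorem1:
  fixes n :: int and f :: "int \<Rightarrow> int"
  assumes "n > 0"
    and "f \<in> carrier (residue_ring n) \<rightarrow> carrier (residue_ring n)"
  shows "\<exists>m :: int. m > 0 \<and>
    (\<exists>a \<in> carrier (residue_ring m).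
      \<exists>j \<in> carrier (residue_ring n) \<rightarrow> carrier (residue_ring m).
        inj_on j (carrier (residue_ring n)) \<and>
        (\<forall>i \<in> carrier (residue_ring n). j (f i) = a \<otimes>\<^bsub>residue_ring m\<^esub> j i))"
proof -
  define X where "X = {0..n - 1}"
  have X: "carrier (residue_ring n) = X"
    by (simp add: X_def residue_ring_def)
  have fX: "f x \<in> X" if "x \<in> X" for x
    using assms(2) that by (auto simp: X)
  have finX: "finite X" and neX: "X \<noteq> {}"
    using assms(1) by (auto simp: X_def)
  obtain p q where pq: "p < q" "\<And>x. x \<in> X \<Longrightarrow> (f ^^ p) x = (f ^^ q) x"
    using finite_funpow_repeats[of X f] finX fX by blast
  \<comment> \<open>In base \<open>n\<close> a fixed point \<open>n - 1\<close> would give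
    \<open>j (n - 1) = m\<close>; the spare digit \<open>n\<close> keeps \<open>j\<close> below
    \<open>m\<close>.\<close>
  define a where "a = n + 1"
  define m where "m = a ^ q - a ^ p"
  \<comment> \<open>The fractional parts of \<open>a ^ q * \<theta> x\<close> and
    \<open>a ^ p * \<theta> x\<close> agree and cancel.\<close>
  define j where "j x = orbit_number a f q x - orbit_number a f p x" for x
  have m: "m > 0"
    using pq(1) assms(1) by (simp add: m_def a_def power_strict_increasing)
  have shift: "a * j x = x * m + j (f x)" if "x \<in> X" for x
    using orbit_number_shift[of a f q x] orbit_number_shift[of a f p x] pq(2)[OF that]
    by (simp add: j_def m_def algebra_simps)

  text \<open>Evaluating \<open>shift\<close> at the points where \<open>j\<close> is extremal bounds \<open>j\<close>.\<close>
  obtain u where u: "u \<in> X" "\<And>x. x \<in> X \<Longrightarrow> j u \<le> j x"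
    using ex_is_arg_min_if_finite[OF finX neX, of j] by (auto simp: is_arg_min_linorder)
  have "n * j u = u * m + (j (f u) - j u)"
    using shift[OF u(1)] by (simp add: a_def algebra_simps)
  moreover have "0 \<le> u * m"
    using u(1) m by (simp add: X_def)
  ultimately have "0 \<le> n * j u"
    using u(2)[OF fX[OF u(1)]] by linarith
  then have "0 \<le> j u"
    using assms(1) by (simp add: zero_le_mult_iff)
  then have lower: "0 \<le> j x" if "x \<in> X" for x
    using u(2)[OF that] by linarith
  obtain v where v: "v \<in> X" "\<And>x. x \<in> X \<Longrightarrow> j x \<le> j v"
    using ex_is_arg_min_if_finite[OF finX neX, of "\<lambda>x. - j x"]
    by (auto simp: is_arg_min_linorder)
  have "n * j v = v * m + (j (f v) - j v)"
    using shift[OF v(1)] by (simp add: a_def algebra_simps)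
  moreover have "v * m < n * m"
    using v(1) m by (simp add: X_def)
  ultimately have "n * j v < n * m"
    using v(2)[OF fX[OF v(1)]] by linarith
  then have "j v < m"
    using assms(1) by simp
  then have upper: "j x < m" if "x \<in> X" for x
    using v(2)[OF that] by linarith

  \<comment> \<open>By the bounds, \<open>shift\<close> is division with remainder by
    \<open>m\<close>; the quotient recovers \<open>x\<close> from \<open>j x\<close>.\<close>
  have lin: "j (f x) = a * j x mod m" and digit: "x = a * j x div m" if "x \<in> X" for x
    using lower[OF fX[OF that]] upper[OF fX[OF that]] m by (simp_all add: shift[OF that])
  have "inj_on j X"
    by (rule inj_onI) (metis digit)
  moreover have "j \<in> X \<rightarrow> carrier (residue_ring m)"
    using lower upper by (force simp: residue_ring_def)
  moreover have "a mod m \<in> carrier (residue_ring m)"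
    using m by (simp add: residue_ring_def)
  moreover have "j (f x) = (a mod m) \<otimes>\<^bsub>residue_ring m\<^esub> j x" if "x \<in> X" for x
    using lin[OF that] by (simp add: residue_ring_def mod_mult_left_eq)
  ultimately show ?thesis
    unfolding X using m by blast
qed

end
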